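(* For every real number $\nu\ge\frac{3+\sqrt5}{2}$ there are infinitely many real numbers $\alpha$ defined by modified Engel or Pierce series, i.e. arising from one of the constructions (E), (P1), (P2) described in the context, with irrationality exponent $\mu(\alpha)=\nu$.
   Context: The irrationality exponent $\mu(\alpha)$ of a real number $\alpha$ is the supremum of the set of real $\mu$ such that $0<|\alpha-P/Q|<1/Q^\mu$ holds for infinitely many rational numbers $P/Q$. Continued fractions: $[a_0;a_1,\dots,a_n]$ denotes the finite continued fraction with $a_0\in\mathbb Z$ and $a_j\in\mathbb Z_{>0}$ for $j\ge1$. The denominators $q_n$ of its convergents satisfy $q_{n+1}=a_{n+1}q_n+q_{n-1}$ for $n\ge-1$, with $q_{-1}=0$, $q_{-2}=1$. Every rational number has such an expansion with last index even, and one with last index odd. Common data: a rational $p/q$ in lowest terms with $q\ge1$, an integer $m\ge0$, and an arbitrary sequence $(u_n)_{n\ge1}$ of positive integers. Given a positive integer $y_0$, the sequences $(y_n)_{n\ge0}$ and $(x_n)_{n\ge1}$ are defined by $x_1=q$, $y_j=y_{j-1}(1+u_jx_j)$, $x_{j+1}=x_jy_j$ for $j\ge1$. (E) Modified Engel series: write $p/q=[a_0;a_1,\dots,a_{2k}]$ (last index even), put $y_0=mq+q_{2k-1}+1$, and let $\alpha=\frac pq+\sum_{j\ge2}\frac1{x_j}$. (P1) Modified Pierce series: assume $q>1$, write $p/q=[a_0;a_1,\dots,a_{2k}]$ (last index even), put $y_0=mq+q_{2k-1}-1$, requiring $m\ge1$ if $q_{2k-1}=1$, and let $\alpha=\frac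 pq+\sum_{j\ge2}\frac{(-1)^j}{x_j}$. (P2) Modified Pierce series: assume $q>1$, write $p/q=[a_0;a_1,\dots,a_{2k+1}]$ (last index odd), put $y_0=mq+q_{2k}-1$, requiring $m\ge1$ if $q_{2k}=1$, and let $\alpha=\frac pq-\sum_{j\ge2}\frac{(-1)^j}{x_j}$. *)

theory Defs
  imports Complex_Main "HOL-Library.Extended_Real"
begin

text \<open>The supremum is taken in the extended reals, so that it is \<open>\<infinity>\<close> (and not a junk value)
  when unbounded. The denominator \<open>Q\<close> is the one of the reduced form of the rational.\<close>

definition irrationality_exponent :: "real \<Rightarrow> ereal" where
  "irrationality_exponent \<alpha> = Sup (ereal ` {\<mu>::real.
     infinite {r::rat. 0 < \<bar>\<alpha> - of_rat r\<bar> \<and>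
                       \<bar>\<alpha> - of_rat r\<bar> < 1 / real_of_int (snd (quotient_of r)) powr \<mu>}})"

text \<open>\<open>cf_value a n\<close> is \<open>[a 0; a 1, \<dots>, a n]\<close>.\<close>

fun cf_value :: "(nat \<Rightarrow> int) \<Rightarrow> nat \<Rightarrow> real" where
  "cf_value a 0 = of_int (a 0)"
| "cf_value a (Suc n) = of_int (a 0) + 1 / cf_value (\<lambda>i. a (Suc i)) n"

definition is_cf_expansion :: "real \<Rightarrow> (nat \<Rightarrow> int) \<Rightarrow> nat \<Rightarrow> bool" where
  "is_cf_expansion r a n \<longleftrightarrow> (\<forall>j\<in>{1..n}. a j > 0) \<and> r = cf_value a n"

text \<open>Denominators of convergents with the index shifted by 2, since they start at
  \<open>q\<^bsub>-2\<^esub> = 1\<close>: \<open>cf_denom a n\<close> is \<open>q\<^bsub>n-2\<^esub>\<close>.\<close>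

fun cf_denom :: "(nat \<Rightarrow> int) \<Rightarrow> nat \<Rightarrow> int" where
  "cf_denom a 0 = 1"
| "cf_denom a (Suc 0) = 0"
| "cf_denom a (Suc (Suc n)) = a n * cf_denom a (Suc n) + cf_denom a n"

text \<open>The sequence \<open>x\<close> starts at index 1 and \<open>u\<close> is used from index 1 only;
  the value of \<open>xseq\<close> at 0 is a dummy.\<close>

fun xseq yseq :: "int \<Rightarrow> int \<Rightarrow> (nat \<Rightarrow> int) \<Rightarrow> nat \<Rightarrow> int" where
  "xseq q y0 u 0 = 0"
| "xseq q y0 u (Suc 0) = q"
| "xseq q y0 u (Suc (Suc j)) = xseq q y0 u (Suc j) * yseq q y0 u (Suc j)"
| "yseq q y0 u 0 = y0"
| "yseq q y0 u (Suc j) = yseq q y0 u j * (1 + u (Suc j) * xseq q y0 u (Suc j))"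

text \<open>In the three definitions below \<open>q\<close> and \<open>y0\<close> are positive, so \<open>yseq q y0 u j \<ge> 2\<close> for
  \<open>j \<ge> 1\<close> and the series converge at least geometrically; their summation variable is shifted,
  the \<open>j\<close>-th term being the one with index \<open>j + 2\<close>.\<close>

definition modified_Engel :: "real set" where
  "modified_Engel = {\<alpha>. \<exists>(p::int) (q::int) (m::nat) (u::nat \<Rightarrow> int) (a::nat \<Rightarrow> int) (k::nat) (y0::int).
     q \<ge> 1 \<and> coprime p q \<and> (\<forall>n\<ge>1. u n > 0) \<and>
     is_cf_expansion (of_int p / of_int q) a (2 * k) \<and>
     y0 = int m * q + cf_denom a (2 * k + 1) + 1 \<and>
     \<alpha> = of_int p / of_int q + (\<Sum>j. 1 / of_int (xseq q y0 u (j + 2)))}"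

definition modified_Pierce_even :: "real set" where
  "modified_Pierce_even = {\<alpha>. \<exists>(p::int) (q::int) (m::nat) (u::nat \<Rightarrow> int) (a::nat \<Rightarrow> int) (k::nat) (y0::int).
     q > 1 \<and> coprime p q \<and> (\<forall>n\<ge>1. u n > 0) \<and>
     is_cf_expansion (of_int p / of_int q) a (2 * k) \<and>
     (cf_denom a (2 * k + 1) = 1 \<longrightarrow> m \<ge> 1) \<and>
     y0 = int m * q + cf_denom a (2 * k + 1) - 1 \<and>
     \<alpha> = of_int p / of_int q + (\<Sum>j. (-1) ^ (j + 2) / of_int (xseq q y0 u (j + 2)))}"

definition modified_Pierce_odd :: "real set" where
  "modified_Pierce_odd = {\<alpha>. \<exists>(p::int) (q::int) (m::nat) (u::nat \<Rightarrow> int) (a::nat \<Rightarrow> int) (k::nat) (y0::int).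
     q > 1 \<and> coprime p q \<and> (\<forall>n\<ge>1. u n > 0) \<and>
     is_cf_expansion (of_int p / of_int q) a (2 * k + 1) \<and>
     (cf_denom a (2 * k + 2) = 1 \<longrightarrow> m \<ge> 1) \<and>
     y0 = int m * q + cf_denom a (2 * k + 2) - 1 \<and>
     \<alpha> = of_int p / of_int q - (\<Sum>j. (-1) ^ (j + 2) / of_int (xseq q y0 u (j + 2)))}"

end

theory Submission imports Defs begin

text \<open>
  Engel series with \<open>q = 1\<close> and \<open>y\<^sub>0 = 1\<close> suffice. Choosing \<open>u\<^sub>j = \<lceil>x\<^sub>j powr (\<nu> - 2) / y\<^bsub>j-1\<^esub>\<rceil>\<close>
  gives \<open>x\<^sub>j powr \<nu> \<le> x\<^bsub>j+1\<^esub> \<le> 8 * x\<^sub>j powr \<nu>\<close>; the upper bound propagates because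
  \<open>1 - 1/\<nu> \<le> \<nu> - 2\<close>, which is the assumption \<open>\<nu>\<^sup>2 - 3\<nu> + 1 \<ge> 0\<close>. The partial sums are reduced
  fractions with denominators \<open>x\<^sub>j\<close> at distance about \<open>1/x\<^bsub>j+1\<^esub>\<close> from \<open>\<alpha>\<close>, so \<open>\<mu>(\<alpha>) \<ge> \<nu>\<close>. Any other
  fraction \<open>P/Q\<close> is compared with the first partial sum for which \<open>4 Q x\<^sub>j \<le> x\<^bsub>j+1\<^esub>\<close>: then
  \<open>\<bar>\<alpha> - P/Q\<bar> \<ge> 1/(2 Q x\<^sub>j)\<close>, and \<open>x\<^sub>j\<close> is at most of order \<open>Q powr (\<nu> - 1)\<close>, again by the
  assumption on \<open>\<nu>\<close>. Varying the integer part gives infinitely many \<open>\<alpha>\<close>.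
\<close>

section \<open>Rational approximations and bounds on the irrationality exponent\<close>

abbreviation den :: "rat \<Rightarrow> int" where
  "den r \<equiv> snd (quotient_of r)"

lemma of_rat_quotient_of:
  "(of_rat r :: real) = of_int (fst (quotient_of r)) / of_int (den r)"
proof -
  have "r = of_int (fst (quotient_of r)) / of_int (den r)"
    by (metis prod.collapse quotient_of_div)
  then show ?thesis by (metis of_rat_divide of_rat_of_int_eq)
qed

text \<open>The numerator is the value times the denominator, hence at most
  \<open>(\<bar>\<alpha>\<bar> + d) * B\<close> in absolute value, which leaves finitely many
  pairs.\<close>

lemma finite_rat_bounded_den:
  fixes \<alpha> d B :: real
  shows "finite {r::rat. \<bar>\<alpha> - of_rat r\<bar> < d \<and> real_of_int (den r) \<le> B}"
proof -
  define M where "M = \<lceil>(\<bar>\<alpha>\<bar> + d) * B\<rceil>"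
  have "{r::rat. \<bar>\<alpha> - of_rat r\<bar> < d \<and> real_of_int (den r) \<le> B}
      \<subseteq> (\<lambda>(a, b). of_int a / of_int b) ` ({-M..M} \<times> {0..\<lceil>B\<rceil>})"
  proof
    fix r :: rat
    assume "r \<in> {r. \<bar>\<alpha> - of_rat r\<bar> < d \<and> real_of_int (den r) \<le> B}"
    then have r: "\<bar>\<alpha> - of_rat r\<bar> < d" and B: "real_of_int (den r) \<le> B" by auto
    have pos: "den r > 0" by (rule quotient_of_denom_pos')
    have "\<bar>real_of_int (fst (quotient_of r))\<bar> = \<bar>of_rat r :: real\<bar> * of_int (den r)"
      using pos by (simp add: of_rat_quotient_of abs_mult)
    also have "\<dots> \<le> (\<bar>\<alpha>\<bar> + d) * B"
      by (rule mult_mono) (use r B pos in linarith)+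
    also have "\<dots> \<le> of_int M" unfolding M_def by linarith
    finally have "\<bar>fst (quotient_of r)\<bar> \<le> M" by linarith
    moreover have "den r \<le> \<lceil>B\<rceil>" using B by linarith
    moreover have "r = of_int (fst (quotient_of r)) / of_int (den r)"
      by (metis prod.collapse quotient_of_div)
    ultimately show "r \<in> (\<lambda>(a, b). of_int a / of_int b) ` ({-M..M} \<times> {0..\<lceil>B\<rceil>})"
      using pos by (intro image_eqI[where x = "quotient_of r"]) (auto simp: case_prod_unfold mem_Times_iff)
  qed
  then show ?thesis by (rule finite_subset) auto
qed

text \<open>If \<open>\<mu> > \<nu>\<close>, both bounds on the distance force
  \<open>Q powr (\<mu> - \<nu>) < 1 / c\<close>; so denominators are bounded and only finitely many
  rationals qualify for \<open>\<mu>\<close>.\<close>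

lemma irrationality_exponent_le:
  fixes \<alpha> \<nu> c :: real
  assumes "c > 0" "\<nu> \<ge> 0"
    and bound: "\<And>r::rat. c / real_of_int (den r) powr \<nu> \<le> \<bar>\<alpha> - of_rat r\<bar>"
  shows "irrationality_exponent \<alpha> \<le> ereal \<nu>"
proof -
  have "\<mu> \<le> \<nu>" if inf: "infinite {r::rat. 0 < \<bar>\<alpha> - of_rat r\<bar> \<and>
          \<bar>\<alpha> - of_rat r\<bar> < 1 / real_of_int (den r) powr \<mu>}" (is "infinite ?S") for \<mu>
  proof (rule ccontr)
    assume "\<not> \<mu> \<le> \<nu>"
    then have less: "\<nu> < \<mu>" by simp
    have "?S \<subseteq> {r::rat. \<bar>\<alpha> - of_rat r\<bar> < 1 \<and> real_of_int (den r) \<le> (1 / c) powr (1 / (\<mu> - \<nu>))}"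
    proof
      fix r assume "r \<in> ?S"
      then have r: "\<bar>\<alpha> - of_rat r\<bar> < 1 / real_of_int (den r) powr \<mu>" by simp
      define Q where "Q = real_of_int (den r)"
      have "1 \<le> den r" using quotient_of_denom_pos'[of r] by linarith
      then have Q: "Q \<ge> 1" by (simp add: Q_def)
      have "c / Q powr \<nu> < 1 / Q powr \<mu>"
        using r bound[of r] by (simp add: Q_def)
      then have "Q powr (\<mu> - \<nu>) < 1 / c"
        using Q \<open>c > 0\<close> by (simp add: powr_diff field_simps)
      then have "(Q powr (\<mu> - \<nu>)) powr (1 / (\<mu> - \<nu>)) \<le> (1 / c) powr (1 / (\<mu> - \<nu>))"
        using less by (intro powr_mono2) auto
      then have 1: "Q \<le> (1 / c) powr (1 / (\<mu> - \<nu>))"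
        using Q less by (simp add: powr_powr)
      \<comment> \<open>As \<open>\<mu>\<close> is positive, every such rational is within distance
        1, the \<open>d\<close> used for finiteness.\<close>
      have "1 \<le> Q powr \<mu>" using Q less \<open>\<nu> \<ge> 0\<close> by (intro ge_one_powr_ge_zero) auto
      then have "1 / Q powr \<mu> \<le> 1 / 1" by (intro divide_left_mono) auto
      then have "\<bar>\<alpha> - of_rat r\<bar> < 1" using r unfolding Q_def by linarith
      with 1 show "r \<in> {r. \<bar>\<alpha> - of_rat r\<bar> < 1 \<and> real_of_int (den r) \<le> (1 / c) powr (1 / (\<mu> - \<nu>))}"
        by (simp add: Q_def)
    qed
    with finite_rat_bounded_den inf show False using finite_subset by blast
  qed
  then show ?thesis
    unfolding irrationality_exponent_def by (intro Sup_least) auto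
qed

lemma irrationality_exponent_ge:
  fixes \<alpha> \<nu> C :: real and s :: "nat \<Rightarrow> rat"
  assumes "inj s" and ne: "\<And>n. \<alpha> \<noteq> of_rat (s n)"
    and lim: "filterlim (\<lambda>n. real_of_int (den (s n))) at_top sequentially"
    and bound: "\<And>n. \<bar>\<alpha> - of_rat (s n)\<bar> \<le> C / real_of_int (den (s n)) powr \<nu>"
  shows "ereal \<nu> \<le> irrationality_exponent \<alpha>"
\<comment> \<open>Exponents strictly below \<open>\<nu>\<close> suffice for the supremum, and the
  slack \<open>\<nu> - \<mu>\<close> absorbs the constant \<open>C\<close>.\<close>
proof (rule dense_le)
  fix z assume z: "z < ereal \<nu>"
  show "z \<le> irrationality_exponent \<alpha>"
  proof (cases z)
    case (real \<mu>)
    then have "\<mu> < \<nu>" using z by simp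
    let ?S = "{r::rat. 0 < \<bar>\<alpha> - of_rat r\<bar> \<and> \<bar>\<alpha> - of_rat r\<bar> < 1 / real_of_int (den r) powr \<mu>}"
    \<comment> \<open>Beyond this threshold \<open>Q powr (\<nu> - \<mu>)\<close> exceeds
      \<open>C\<close>; using \<open>\<bar>C\<bar> + 1\<close> keeps the base positive whatever the
      sign of \<open>C\<close>.\<close>
    have "eventually (\<lambda>n. real_of_int (den (s n)) > (\<bar>C\<bar> + 1) powr (1 / (\<nu> - \<mu>))) sequentially"
      using lim by (simp add: filterlim_at_top_dense)
    then obtain n0 where n0: "\<And>n. n \<ge> n0 \<Longrightarrow> real_of_int (den (s n)) > (\<bar>C\<bar> + 1) powr (1 / (\<nu> - \<mu>))"
      by (auto simp: eventually_sequentially)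
    have "s ` {n0..} \<subseteq> ?S"
    proof (rule image_subsetI, rule CollectI, rule conjI)
      fix n assume "n \<in> {n0..}"
      define Q where "Q = real_of_int (den (s n))"
      have Q: "Q > 0" unfolding Q_def using quotient_of_denom_pos' by simp
      have "((\<bar>C\<bar> + 1) powr (1 / (\<nu> - \<mu>))) powr (\<nu> - \<mu>) < Q powr (\<nu> - \<mu>)"
        using n0[of n] \<open>n \<in> _\<close> \<open>\<mu> < \<nu>\<close> by (intro powr_less_mono2) (auto simp: Q_def)
      then have "C < Q powr (\<nu> - \<mu>)"
        using \<open>\<mu> < \<nu>\<close> by (simp add: powr_powr)
      then have "C / Q powr \<nu> < 1 / Q powr \<mu>"
        using Q by (simp add: powr_diff field_simps)
      then show "\<bar>\<alpha> - of_rat (s n)\<bar> < 1 / real_of_int (den (s n)) powr \<mu>"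
        using bound[of n] by (simp add: Q_def)
      show "0 < \<bar>\<alpha> - of_rat (s n)\<bar>" using ne[of n] by simp
    qed
    moreover have "infinite (s ` {n0..})"
      using \<open>inj s\<close> by (metis finite_imageD inj_on_subset infinite_Ici subset_UNIV)
    ultimately have "infinite ?S" using finite_subset by blast
    then show ?thesis
      unfolding irrationality_exponent_def real by (intro Sup_upper) auto
  qed (use z in auto)
qed

text \<open>Separates the Diophantine argument from the series: \<open>lower\<close> and
  \<open>close\<close> give exponent at least \<open>\<nu>\<close>, \<open>upper\<close> and
  \<open>far\<close> control the fractions \<open>N n / X n\<close> themselves, and
  \<open>incr\<close> makes these pairwise distinct.\<close>

lemma irrationality_exponent_eq:
  fixes \<alpha> \<nu> C :: real and N X :: "nat \<Rightarrow> int"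
  assumes \<nu>: "\<nu> \<ge> 2" "1 \<le> (\<nu> - 1) * (\<nu> - 2)"
    and X0: "X 0 = 1" and Xmono: "strict_mono X"
    and cop: "\<And>n. coprime (N n) (X n)"
    and lower: "\<And>n. X n powr \<nu> \<le> X (Suc n)"
    and upper: "\<And>n. X (Suc n) \<le> C * X n powr \<nu>"
    and close: "\<And>n. \<bar>\<alpha> - N n / X n\<bar> \<le> 2 / X (Suc n)"
    and far: "\<And>n. 1 / X (Suc n) \<le> \<bar>\<alpha> - N n / X n\<bar>"
    and incr: "strict_mono (\<lambda>n. N n / X n :: real)"
  shows "irrationality_exponent \<alpha> = ereal \<nu>"
proof (rule antisym)
  have Xn: "X n \<ge> int n + 1" for n
  proof (induction n)
    case (Suc n)
    then show ?case using strict_monoD[OF Xmono, of n "Suc n"] by simp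
  qed (simp add: X0)
  then have X1: "X n \<ge> 1" for n using le_trans by (smt (verit) of_nat_0_le_iff)
  have Xpos: "X n > 0" for n using X1[of n] by linarith
  have C: "C > 0" using upper[of 0] Xpos[of "Suc 0"] by (simp add: X0)
  define s where "s n = Rat.Fract (N n) (X n)" for n
  have s: "of_rat (s n) = (N n / X n :: real)" for n
    using Xpos[of n] by (simp add: s_def of_rat_rat)
  have den_s: "den (s n) = X n" for n
    using cop[of n] Xpos[of n] by (simp add: s_def quotient_of_Fract Rat.normalize_def)
  show "ereal \<nu> \<le> irrationality_exponent \<alpha>"
  proof (rule irrationality_exponent_ge[where s = s and C = 2])
    show "inj s" using strict_mono_imp_inj_on[OF incr]
      by (metis (mono_tags, lifting) injD injI s)
    show "\<alpha> \<noteq> of_rat (s n)" for n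
      using far[of n] Xpos[of "Suc n"] by (auto simp: s)
    show "filterlim (\<lambda>n. real_of_int (den (s n))) at_top sequentially"
      unfolding den_s
    proof (rule filterlim_at_top_mono[OF filterlim_real_sequentially], rule always_eventually, rule allI)
      show "real n \<le> real_of_int (X n)" for n using Xn[of n] by linarith
    qed
    show "\<bar>\<alpha> - of_rat (s n)\<bar> \<le> 2 / real_of_int (den (s n)) powr \<nu>" for n
    proof -
      have "2 / X (Suc n) \<le> 2 / X n powr \<nu>"
        using lower[of n] Xpos[of n] Xpos[of "Suc n"] by (intro divide_left_mono) auto
      then show ?thesis using close[of n] by (simp add: s den_s)
    qed
  qed
  \<comment> \<open>The first constant serves the fractions \<open>s n\<close>, the second all other
    rationals.\<close>
  define c where "c = min (1 / C) (1 / (2 * 4 powr (\<nu> - 1)))"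
  show "irrationality_exponent \<alpha> \<le> ereal \<nu>"
  proof (rule irrationality_exponent_le)
    show "c > 0" using C by (simp add: c_def)
    show "\<nu> \<ge> 0" using \<nu> by simp
    fix r :: rat
    define P where "P = fst (quotient_of r)"
    define Q where "Q = den r"
    have "Q > 0" unfolding Q_def by (rule quotient_of_denom_pos')
    then have Q: "real_of_int Q \<ge> 1" by simp
    \<comment> \<open>Since \<open>\<nu> \<ge> 2\<close>, \<open>X (Suc n)\<close> is at least the
      square of \<open>X n\<close>, so any \<open>n\<close> with \<open>X n \<ge> 4 * Q\<close>
      works.\<close>
    have ex: "\<exists>n. 4 * Q * X n \<le> X (Suc n)"
    proof
      let ?n = "nat (4 * Q)"
      have 1: "4 * Q \<le> X ?n" using Xn[of ?n] \<open>Q > 0\<close> by simp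
      have "X ?n powr 2 \<le> X ?n powr \<nu>" using \<nu> X1[of ?n] by (intro powr_mono) auto
      then have "real_of_int (X ?n) ^ 2 \<le> X ?n powr \<nu>" using Xpos[of ?n] by simp
      then have "real_of_int (X ?n) ^ 2 \<le> real_of_int (X (Suc ?n))" using lower order_trans by blast
      then have "X ?n ^ 2 \<le> X (Suc ?n)" by (metis of_int_le_iff of_int_power)
      moreover have "4 * Q * X ?n \<le> X ?n ^ 2"
        unfolding power2_eq_square using 1 Xpos[of ?n] by (intro mult_right_mono) auto
      ultimately show "4 * Q * X ?n \<le> X (Suc ?n)" by linarith
    qed
    define n where "n = (LEAST n. 4 * Q * X n \<le> X (Suc n))"
    have n: "4 * Q * X n \<le> X (Suc n)" unfolding n_def using ex by (rule LeastI_ex)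
    \<comment> \<open>Minimality gives \<open>X n < 4 * Q * X k\<close> for the predecessor
      \<open>k\<close>. With \<open>lower\<close> this yields
      \<open>X k powr (\<nu> - 1) < 4 * Q\<close>, and raising to the power \<open>\<nu> - 2\<close>
      bounds \<open>X k\<close> because \<open>(\<nu> - 1) * (\<nu> - 2) \<ge> 1\<close>.\<close>
    have x: "X n \<le> (4 * Q) powr (\<nu> - 1)"
    proof (cases n)
      case 0
      then show ?thesis using Q \<nu> by (auto simp: X0 intro!: ge_one_powr_ge_zero)
    next
      case (Suc k)
      have "\<not> 4 * Q * X k \<le> X (Suc k)"
        using not_less_Least[of k "\<lambda>n. 4 * Q * X n \<le> X (Suc n)"] Suc n_def by simp
      then have k: "real_of_int (X (Suc k)) < 4 * Q * X k"
        by (metis not_le of_int_less_iff of_int_mult of_int_numeral)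
      have xk: "real_of_int (X k) \<ge> 1" using X1[of k] by simp
      have "X k powr \<nu> < 4 * Q * X k" using k lower[of k] by linarith
      then have "X k powr (\<nu> - 1) < 4 * Q" using xk by (simp add: powr_diff field_simps)
      then have "(X k powr (\<nu> - 1)) powr (\<nu> - 2) \<le> (4 * Q) powr (\<nu> - 2)"
        using \<nu> by (intro powr_mono2) auto
      moreover have "X k powr 1 \<le> X k powr ((\<nu> - 1) * (\<nu> - 2))"
        using xk \<nu> by (intro powr_mono) auto
      ultimately have "X k \<le> (4 * Q) powr (\<nu> - 2)" using xk by (simp add: powr_powr)
      then have "4 * Q * X k \<le> (4 * Q) powr 1 * (4 * Q) powr (\<nu> - 2)"
        using Q by simp
      also have "\<dots> = (4 * Q) powr (\<nu> - 1)" by (subst powr_add[symmetric]) simp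
      finally show ?thesis using k Suc by simp
    qed
    have "c / Q powr \<nu> \<le> \<bar>\<alpha> - of_rat r\<bar>"
    proof (cases "r = s n")
      case True
      then have QX: "Q = X n" by (simp add: Q_def den_s)
      have "c / Q powr \<nu> \<le> (1 / C) / Q powr \<nu>"
        by (intro divide_right_mono) (auto simp: c_def)
      also have "\<dots> = 1 / (C * X n powr \<nu>)" by (simp add: QX)
      also have "\<dots> \<le> 1 / X (Suc n)"
        using upper[of n] Xpos[of "Suc n"] Xpos[of n] C by (intro divide_left_mono) auto
      also have "\<dots> \<le> \<bar>\<alpha> - of_rat r\<bar>" using far[of n] by (simp add: True s)
      finally show ?thesis .
    next
      case False
      have r: "of_rat r = (P / Q :: real)" by (simp add: of_rat_quotient_of P_def Q_def)
      have "(of_rat r :: real) \<noteq> of_rat (s n)" using False by simp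
      then have "P * X n - N n * Q \<noteq> 0"
        using Xpos[of n] \<open>Q > 0\<close> unfolding r s
        by (auto simp: field_simps simp flip: of_int_mult)
      then have "\<bar>P * X n - N n * Q\<bar> \<ge> 1" by linarith
      then have "\<bar>real_of_int (P * X n - N n * Q)\<bar> \<ge> 1" by linarith
      moreover have "(of_rat r - of_rat (s n) :: real) = real_of_int (P * X n - N n * Q) / (Q * X n)"
        using Xpos[of n] \<open>Q > 0\<close> unfolding r s by (simp add: field_simps)
      ultimately have "\<bar>of_rat r - of_rat (s n) :: real\<bar> \<ge> 1 / (Q * X n)"
        using Xpos[of n] \<open>Q > 0\<close> by (simp add: abs_mult divide_right_mono)
      moreover have "2 / X (Suc n) \<le> 1 / (2 * Q * X n)"
      proof -
        have "real_of_int (4 * Q * X n) \<le> X (Suc n)" using n by (simp only: of_int_le_iff)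
        then show ?thesis using Xpos[of n] \<open>Q > 0\<close> Xpos[of "Suc n"] by (simp add: field_simps)
      qed
      \<comment> \<open>Distinct fractions differ by at least \<open>1 / (Q * X n)\<close>. The
        distance from \<open>s n\<close> to \<open>\<alpha>\<close> uses up at most half of this
        gap; the other half remains.\<close>
      moreover have "1 / (Q * X n) = 1 / (2 * Q * X n) + 1 / real_of_int (2 * Q * X n)"
        by simp
      ultimately have far': "1 / (2 * Q * X n) \<le> \<bar>\<alpha> - of_rat r\<bar>"
        using close[of n] unfolding s[symmetric] by simp
      have "c / Q powr \<nu> \<le> (1 / (2 * 4 powr (\<nu> - 1))) / Q powr \<nu>"
        by (intro divide_right_mono) (auto simp: c_def)
      also have "\<dots> = 1 / (2 * Q * (4 * Q) powr (\<nu> - 1))"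
        using Q by (simp add: powr_mult powr_diff)
      also have "\<dots> \<le> 1 / (2 * Q * X n)"
        using x Q Xpos[of n] by (intro divide_left_mono mult_left_mono) auto
      also note far'
      finally show ?thesis .
    qed
    then show "c / real_of_int (den r) powr \<nu> \<le> \<bar>\<alpha> - of_rat r\<bar>" by (simp add: Q_def)
  qed
qed

section \<open>Recursive choice of the multipliers \<open>u\<close>\<close>

lemma xseq_yseq_feedback:
  fixes F :: "int \<Rightarrow> int \<Rightarrow> int"
  obtains u where "\<And>n. u (Suc n) = F (xseq q y0 u (Suc n)) (yseq q y0 u n)"
proof -
  \<comment> \<open>\<open>xseq\<close> and \<open>yseq\<close> take all of \<open>u\<close>, but
    the entries at \<open>Suc n\<close> and \<open>n\<close> depend only on \<open>u 1\<close> up to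
    \<open>u n\<close>. So these pairs can be built first and \<open>u\<close> read off;
    \<open>u 0\<close> is a dummy.\<close>
  define st where "st = rec_nat (q, y0) (\<lambda>_ (x, y). let y' = y * (1 + F x y * x) in (x * y', y'))"
  define u where "u n = F (fst (st (n - 1))) (snd (st (n - 1)))" for n
  have "xseq q y0 u (Suc n) = fst (st n) \<and> yseq q y0 u n = snd (st n)" for n
  proof (induction n)
    case (Suc n)
    then show ?case by (simp add: st_def u_def Let_def case_prod_unfold)
  qed (simp add: st_def)
  then have "u (Suc n) = F (xseq q y0 u (Suc n)) (yseq q y0 u n)" for n
    by (simp add: u_def)
  then show thesis by (rule that)
qed

section \<open>Engel series with \<open>q = 1\<close> and initial value 1 for
  \<open>yseq\<close>\<close>

locale Engel_one =
  fixes u :: "nat \<Rightarrow> int"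
  assumes u_pos: "\<And>n. u (Suc n) \<ge> 1"
begin

text \<open>The shift makes \<open>X n\<close> the denominator of the partial sum with
  \<open>n\<close> terms added to the integer part.\<close>

definition X :: "nat \<Rightarrow> int" where "X n = xseq 1 1 u (Suc n)"
definition Y :: "nat \<Rightarrow> int" where "Y n = yseq 1 1 u n"

lemma X_0: "X 0 = 1" and Y_0: "Y 0 = 1"
  and X_Suc: "X (Suc n) = X n * Y (Suc n)"
  and Y_Suc: "Y (Suc n) = Y n * (1 + u (Suc n) * X n)"
  by (simp_all add: X_def Y_def)

lemma XY_pos: "X n \<ge> 1 \<and> Y n \<ge> 1"
proof (induction n)
  case (Suc n)
  have "u (Suc n) * X n \<ge> 1" using u_pos[of n] Suc by (smt (verit) mult_pos_pos)
  then have "Y (Suc n) \<ge> 1" unfolding Y_Suc using Suc by (smt (verit) mult_pos_pos)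
  moreover from this have "X (Suc n) \<ge> 1" unfolding X_Suc using Suc by (smt (verit) mult_pos_pos)
  ultimately show ?case by simp
qed (simp add: X_0 Y_0)

lemma X_pos: "X n > 0" and Y_pos: "Y n > 0"
  using XY_pos[of n] by auto

lemma Y_ge_2: "Y (Suc n) \<ge> 2"
proof -
  have "u (Suc n) * X n \<ge> 1" using u_pos[of n] X_pos[of n] by (smt (verit) mult_pos_pos)
  then have "1 * 2 \<le> Y n * (1 + u (Suc n) * X n)"
    using XY_pos[of n] by (intro mult_mono) auto
  then show ?thesis by (simp add: Y_Suc)
qed

lemma X_double: "2 * X n \<le> X (Suc n)"
  using Y_ge_2[of n] X_pos[of n] by (simp add: X_Suc mult.commute mult_left_mono)

lemma strict_mono_X: "strict_mono X"
  unfolding strict_mono_Suc_iff using X_double X_pos by (smt (verit))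

lemma X_geometric: "real_of_int (X (n + i)) \<ge> 2 ^ i * real_of_int (X n)"
proof (induction i)
  case (Suc i)
  have "real_of_int (X (Suc (n + i))) \<ge> 2 * real_of_int (X (n + i))"
    using X_double[of "n + i"] by linarith
  with Suc show ?case by simp
qed simp

lemma inverse_X_le: "1 / real_of_int (X (n + i)) \<le> 1 / real_of_int (X n) * (1 / 2) ^ i"
proof -
  have "1 / real_of_int (X (n + i)) \<le> 1 / (2 ^ i * real_of_int (X n))"
    using X_geometric[of i n] X_pos by (intro divide_left_mono) auto
  then show ?thesis by (simp add: power_one_over field_simps)
qed

lemma summable_inverse_X: "summable (\<lambda>j. 1 / real_of_int (X (n + j)))"
proof (rule summable_comparison_test)
  show "\<exists>N. \<forall>j\<ge>N. norm (1 / real_of_int (X (n + j))) \<le> 1 / real_of_int (X n) * (1 / 2) ^ j"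
    using inverse_X_le X_pos by (intro exI[of _ 0]) (simp add: less_imp_le)
qed (intro summable_mult summable_geometric, simp)

text \<open>The denominators at least double, so a geometric series of ratio 1/2 dominates.\<close>

lemma tail_le: "(\<Sum>j. 1 / real_of_int (X (n + j))) \<le> 2 / X n"
proof -
  have "(\<Sum>j. 1 / real_of_int (X (n + j))) \<le> (\<Sum>j. 1 / real_of_int (X n) * (1 / 2) ^ j)"
    by (intro suminf_le summable_inverse_X inverse_X_le summable_mult summable_geometric) simp
  also have "\<dots> = 2 / X n"
    by (subst suminf_mult) (auto simp: suminf_geometric)
  finally show ?thesis .
qed

lemma tail_ge: "1 / real_of_int (X n) \<le> (\<Sum>j. 1 / real_of_int (X (n + j)))"
  using sum_le_suminf[OF summable_inverse_X[of n], of "{0}"] X_pos by (simp add: less_imp_le)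

text \<open>The sum starts at \<open>X 1\<close>, the second entry of \<open>xseq\<close>; the first
  entry is the denominator of \<open>p / 1\<close>.\<close>

definition val :: "int \<Rightarrow> real" where
  "val p = of_int p + (\<Sum>j. 1 / real_of_int (X (Suc j)))"

lemma val_in_modified_Engel: "val p \<in> modified_Engel"
proof -
  have "\<forall>n\<ge>1. u n > 0"
  proof (intro allI impI)
    fix n :: nat assume "n \<ge> 1"
    then show "u n > 0" using u_pos[of "n - 1"] by simp
  qed
  \<comment> \<open>With last index 0 no partial quotient has to be positive, so \<open>p\<close>
    may be any integer. The denominator of index -1 is 0, hence \<open>m = 0\<close> gives initial
    value 1.\<close>
  moreover have "is_cf_expansion (of_int p / of_int 1) (\<lambda>_. p) (2 * 0)"
    by (simp add: is_cf_expansion_def)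
  moreover have "(1::int) = int 0 * 1 + cf_denom (\<lambda>_. p) (2 * 0 + 1) + 1" by simp
  moreover have "val p = of_int p / of_int 1 + (\<Sum>j. 1 / of_int (xseq 1 1 u (j + 2)))"
    by (simp add: val_def X_def)
  ultimately show ?thesis unfolding modified_Engel_def
    by (intro CollectI exI[of _ p] exI[of _ 1] exI[of _ 0] exI[of _ u] exI[of _ "\<lambda>_. p"]) auto
qed

text \<open>Numerator of the partial sum over \<open>X n\<close>: passing to the denominator
  \<open>X n * Y (Suc n)\<close> multiplies by \<open>Y (Suc n)\<close>, and the new term adds
  1.\<close>

fun numer :: "int \<Rightarrow> nat \<Rightarrow> int" where
  "numer p 0 = p"
| "numer p (Suc n) = numer p n * Y (Suc n) + 1"

text \<open>Since \<open>Y n\<close> divides \<open>Y (Suc n)\<close>, every prime factor of \<open>X n = Y 1 * \<dots> * Y n\<close> divides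
  \<open>Y n\<close>.\<close>

lemma coprime_X: "coprime z (Y n) \<Longrightarrow> coprime z (X n)"
proof (induction n)
  case (Suc n)
  from Suc.prems have "coprime z (Y n)" by (simp add: Y_Suc)
  with Suc show ?case by (simp add: X_Suc)
qed (simp add: X_0)

text \<open>The numerator is 1 modulo \<open>Y n\<close> for positive \<open>n\<close>, and
  coprimality to \<open>Y n\<close> passes to \<open>X n\<close>.\<close>

lemma coprime_numer_X: "coprime (numer p n) (X n)"
proof (cases n)
  case (Suc k)
  have "coprime (numer p (Suc k)) (Y (Suc k))"
  proof (rule coprimeI)
    fix c assume "c dvd numer p (Suc k)" "c dvd Y (Suc k)"
    then show "is_unit c" by (simp add: dvd_add_right_iff)
  qed
  then show ?thesis using Suc coprime_X by blast
qed (simp add: X_0)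

lemma numer_div_X: "numer p n / X n = of_int p + (\<Sum>j<n. 1 / real_of_int (X (Suc j)))"
proof (induction n)
  case (Suc n)
  have "numer p (Suc n) / X (Suc n) = numer p n / X n + 1 / real_of_int (X (Suc n))"
    using X_pos[of n] Y_pos[of "Suc n"] by (simp add: X_Suc field_simps)
  then show ?case using Suc by simp
qed (simp add: X_0)

lemma val_diff: "val p - numer p n / X n = (\<Sum>j. 1 / real_of_int (X (Suc n + j)))"
  using suminf_split_initial_segment[OF summable_inverse_X[of 1], of n]
  by (simp add: numer_div_X val_def add.commute)

lemma strict_mono_numer_div_X: "strict_mono (\<lambda>n. numer p n / X n :: real)"
  using X_pos by (simp add: strict_mono_Suc_iff numer_div_X del: numer.simps)

lemma irrationality_exponent_val:
  fixes \<nu> C :: real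
  assumes "\<nu> \<ge> 2" "1 \<le> (\<nu> - 1) * (\<nu> - 2)"
    and "\<And>n. X n powr \<nu> \<le> X (Suc n)" "\<And>n. X (Suc n) \<le> C * X n powr \<nu>"
  shows "irrationality_exponent (val p) = ereal \<nu>"
proof (rule irrationality_exponent_eq[where X = X and N = "numer p" and C = C])
  fix n
  have "0 < 1 / real_of_int (X (Suc n))" using X_pos[of "Suc n"] by simp
  then show "\<bar>val p - numer p n / X n\<bar> \<le> 2 / X (Suc n)"
    and "1 / X (Suc n) \<le> \<bar>val p - numer p n / X n\<bar>"
    using tail_le[of "Suc n"] tail_ge[of "Suc n"] unfolding val_diff by linarith+
qed (use assms X_0 strict_mono_X coprime_numer_X strict_mono_numer_div_X in auto)

text \<open>The ceiling puts \<open>u (Suc n) * Y n\<close> between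
  \<open>X n powr (\<nu> - 2)\<close> and that plus \<open>Y n\<close>, and \<open>X (Suc n)\<close>
  is this product times the square of \<open>X n\<close>, up to a factor 2. It remains to keep
  \<open>Y n\<close> of order at most \<open>X n powr (\<nu> - 2)\<close>.\<close>

lemma irrationality_exponent_val_ceiling:
  fixes \<nu> :: real
  assumes \<nu>: "\<nu> \<ge> 2" "1 \<le> (\<nu> - 1) * (\<nu> - 2)"
    and u: "\<And>n. u (Suc n) = \<lceil>real_of_int (X n) powr (\<nu> - 2) / Y n\<rceil>"
  shows "irrationality_exponent (val p) = ereal \<nu>"
proof (rule irrationality_exponent_val[OF \<nu>])
  fix n
  define x where "x = real_of_int (X n)"
  define y where "y = real_of_int (Y n)"
  define w where "w = real_of_int (u (Suc n))"
  have x: "x \<ge> 1" and y: "y \<ge> 1" using XY_pos[of n] by (simp_all add: x_def y_def)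
  have w: "w \<ge> 1" using u_pos[of n] by (simp add: w_def)
  have "x powr (\<nu> - 2) / y \<le> w" by (simp add: w_def u x_def y_def)
  then have wl: "x powr (\<nu> - 2) \<le> w * y" using y by (simp add: field_simps)
  have Y': "real_of_int (Y (Suc n)) = y * (1 + w * x)" by (simp add: Y_Suc x_def y_def w_def)
  have X': "real_of_int (X (Suc n)) = x * Y (Suc n)" by (simp add: X_Suc x_def)
  have "x powr \<nu> = x powr (\<nu> - 2) * (x * x)"
    using x by (simp add: powr_diff power2_eq_square)
  also have "\<dots> \<le> w * y * (x * x)" using wl x by (intro mult_right_mono) auto
  also have "\<dots> \<le> X (Suc n)" unfolding X' Y' using x y w by (simp add: algebra_simps)
  finally show "X n powr \<nu> \<le> X (Suc n)" by (simp add: x_def)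
next
  have step: "Y (Suc n) \<le> 8 * X n powr (\<nu> - 1)" if "Y n \<le> 3 * X n powr (1 - 1 / \<nu>)" for n
  proof -
    define x where "x = real_of_int (X n)"
    define y where "y = real_of_int (Y n)"
    define w where "w = real_of_int (u (Suc n))"
    have x: "x \<ge> 1" and y: "y \<ge> 1" using XY_pos[of n] by (simp_all add: x_def y_def)
    have w: "w \<ge> 1" using u_pos[of n] by (simp add: w_def)
    have "w \<le> x powr (\<nu> - 2) / y + 1" unfolding w_def u x_def y_def by linarith
    then have wu: "w * y \<le> x powr (\<nu> - 2) + y" using y by (simp add: field_simps)
    \<comment> \<open>Multiplied by \<open>\<nu>\<close>, this is exactly
      \<open>1 \<le> (\<nu> - 1) * (\<nu> - 2)\<close>.\<close>
    have "1 - 1 / \<nu> \<le> \<nu> - 2" using \<nu> by (simp add: field_simps)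
    then have "x powr (1 - 1 / \<nu>) \<le> x powr (\<nu> - 2)" using x by (intro powr_mono) auto
    then have "y \<le> 3 * x powr (\<nu> - 2)" using that by (simp add: x_def y_def)
    with wu have 1: "w * y \<le> 4 * x powr (\<nu> - 2)" by linarith
    \<comment> \<open>Replacing \<open>1 + w * x\<close> by \<open>2 * (w * x)\<close> doubles the
      constant 4 to 8.\<close>
    have "1 \<le> w * x" using w x mult_mono[of 1 w 1 x] by simp
    then have "y * (1 + w * x) \<le> y * (2 * (w * x))" using y by (intro mult_left_mono) auto
    also have "\<dots> = 2 * x * (w * y)" by simp
    also have "\<dots> \<le> 2 * x * (4 * x powr (\<nu> - 2))" using 1 x by (intro mult_left_mono) auto
    also have "\<dots> = 8 * x powr (\<nu> - 1)" using x by (simp add: powr_diff power2_eq_square)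
    finally show ?thesis by (simp add: Y_Suc x_def y_def w_def)
  qed
  \<comment> \<open>The exponent is \<open>(\<nu> - 1) / \<nu>\<close>: \<open>Y (Suc n)\<close> is
    of order at most \<open>X n powr (\<nu> - 1)\<close>, while \<open>X (Suc n)\<close> has order
    \<open>X n powr \<nu>\<close>.\<close>
  have inv: "Y n \<le> 3 * X n powr (1 - 1 / \<nu>)" for n
  proof (induction n)
    case (Suc n)
    define x where "x = real_of_int (X n)"
    define y where "y = real_of_int (Y (Suc n))"
    have x: "x \<ge> 1" and y: "y \<ge> 1"
      using XY_pos[of n] XY_pos[of "Suc n"] by (simp_all add: x_def y_def)
    \<comment> \<open>As 8 is below 9, the root of order \<open>\<nu>\<close> turns the factor 8
      back into at most 3.\<close>
    have "(3::real) powr 2 \<le> 3 powr \<nu>" using \<nu> by (intro powr_mono) auto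
    then have "8 * x powr (\<nu> - 1) \<le> 3 powr \<nu> * x powr (\<nu> - 1)"
      by (intro mult_right_mono) auto
    then have "y \<le> 3 powr \<nu> * x powr (\<nu> - 1)"
      using step[OF Suc] by (simp add: x_def y_def)
    then have "y powr (1 / \<nu>) \<le> (3 powr \<nu> * x powr (\<nu> - 1)) powr (1 / \<nu>)"
      using y \<nu> by (intro powr_mono2) auto
    also have "\<dots> = 3 * x powr (1 - 1 / \<nu>)"
      using \<nu> x by (simp add: powr_mult powr_powr diff_divide_distrib)
    \<comment> \<open>The extra factor restores \<open>y\<close> on the left and produces
      \<open>x * y\<close>, which is \<open>X (Suc n)\<close>, on the right.\<close>
    finally have "y powr (1 / \<nu>) * y powr (1 - 1 / \<nu>) \<le> 3 * x powr (1 - 1 / \<nu>) * y powr (1 - 1 / \<nu>)"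
      by (intro mult_right_mono) auto
    then have "y \<le> 3 * (x * y) powr (1 - 1 / \<nu>)"
      using x y by (simp add: powr_mult mult.assoc flip: powr_add)
    then show ?case by (simp add: x_def y_def X_Suc)
  qed (simp add: X_0 Y_0)
  fix n
  have "real_of_int (X (Suc n)) \<le> X n * (8 * X n powr (\<nu> - 1))"
    using step[OF inv[of n]] X_pos[of n] by (simp add: X_Suc)
  also have "\<dots> = 8 * X n powr \<nu>" using X_pos[of n] by (simp add: powr_diff)
  finally show "X (Suc n) \<le> 8 * X n powr \<nu>" .
qed

end

section \<open>Infinitely many Engel series of exponent \<open>\<nu>\<close>\<close>

theorem theorem3p4:
  fixes \<nu> :: real
  assumes "\<nu> \<ge> (3 + sqrt 5) / 2"
  shows "infinite {\<alpha> \<in> modified_Engel \<union> modified_Pierce_even \<union> modified_Pierce_odd.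
                     irrationality_exponent \<alpha> = ereal \<nu>}"
proof -
  have "(3 + 1) / 2 \<le> (3 + sqrt 5) / 2" by (intro divide_right_mono add_left_mono) auto
  from order_trans[OF this assms] have \<nu>2: "\<nu> \<ge> 2" by simp
  \<comment> \<open>Completing the square turns the bound on \<open>\<nu>\<close> into the quadratic
    inequality.\<close>
  have "sqrt 5 ^ 2 \<le> (2 * \<nu> - 3) ^ 2" using assms by (intro power_mono) auto
  then have \<nu>: "1 \<le> (\<nu> - 1) * (\<nu> - 2)" by (simp add: power2_eq_square algebra_simps)
  obtain u where u: "\<And>n. u (Suc n)
      = \<lceil>real_of_int (xseq 1 1 u (Suc n)) powr (\<nu> - 2) / yseq 1 1 u n\<rceil>"
    using xseq_yseq_feedback[of "\<lambda>x y. \<lceil>real_of_int x powr (\<nu> - 2) / y\<rceil>" 1 1] by blast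
  \<comment> \<open>The three bounds need a joint induction: the ceiling is positive because
    \<open>x\<close> and \<open>y\<close> are, and these stay positive because \<open>u\<close>
    is.\<close>
  have pos: "xseq 1 1 u (Suc n) \<ge> 1 \<and> yseq 1 1 u n \<ge> 1 \<and> u (Suc n) \<ge> 1" for n
  proof (induction n)
    case 0
    then show ?case using u[of 0] by simp
  next
    case (Suc n)
    let ?x = "xseq 1 1 u (Suc n)" and ?y = "yseq 1 1 u n"
    have "u (Suc n) * ?x > 0" using Suc by (smt (verit) mult_pos_pos)
    then have y: "yseq 1 1 u (Suc n) > 0" using Suc by (smt (verit) mult_pos_pos yseq.simps(2))
    then have x: "xseq 1 1 u (Suc (Suc n)) > 0" using Suc by (smt (verit) mult_pos_pos xseq.simps(3))
    have "u (Suc (Suc n)) > 0" unfolding u[of "Suc n"] zero_less_ceiling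
      using x y by (intro divide_pos_pos) (simp_all del: xseq.simps yseq.simps)
    with x y show ?case by simp
  qed
  interpret Engel_one u by standard (use pos in blast)
  have exp: "irrationality_exponent (val p) = ereal \<nu>" for p
    using \<nu>2 \<nu> u by (intro irrationality_exponent_val_ceiling) (simp_all add: X_def Y_def)
  \<comment> \<open>The sequence \<open>u\<close> does not depend on \<open>p\<close>, so the values
    are integer translates of one number.\<close>
  have "inj val" by (auto simp: inj_def val_def)
  then have "infinite (range val)" by (simp add: finite_image_iff infinite_UNIV_int)
  moreover have "range val \<subseteq> {\<alpha> \<in> modified_Engel \<union> modified_Pierce_even \<union> modified_Pierce_odd.
      irrationality_exponent \<alpha> = ereal \<nu>}"
    using exp val_in_modified_Engel by auto
  ultimately show ?thesis using finite_subset by blast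
qed

end
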